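(* Consider decomposable POMDPs with $M$ components and horizon $T\ge2$, the linear program (LP) defined in the context, and the following equalities (C) in additional real variables $\tau_{s'a'soa}^{t,m}$, for $m\in[M]$ and $2\le t\le T$: $$\sum_{s'\in\mathcal{X}_S^m,a'\in\mathcal{X}_A}\tau_{s'a'soa}^{t,m}=\tau_{soa}^{t,m}\quad\forall s\in\mathcal{X}_S^m,o\in\mathcal{X}_O^m,a\in\mathcal{X}_A,$$ $$\sum_{a\in\mathcal{X}_A}\tau_{s'a'soa}^{t,m}=p_m(o|s)\,p_m(s|s',a')\,\tau_{s'a'}^{t-1,m}\quad\forall s,s'\in\mathcal{X}_S^m,o\in\mathcal{X}_O^m,a'\in\mathcal{X}_A,$$ $$\tau_{s'a'soa}^{t,m}=p_m(s|s',a',o)\sum_{\bar s\in\mathcal{X}_S^m}\tau_{s'a'\bar soa}^{t,m}\quad\forall s,s'\in\mathcal{X}_S^m,o\in\mathcal{X}_O^m,a,a'\in\mathcal{X}_A.$$ (i) For every such decomposable POMDP, the linear program obtained by adding (C) for all $m\in[M]$ and $2\le t\le T$ to (LP) is still a relaxation of the problem $v_M^*=\max_{\delta\in\Delta}\mathbb{E}_\delta\big[\sum_{t=1}^T\sum_{m=1}^M r_m(S_t^m,A_t,S_{t+1}^m)\big]$ over memoryless policies (for every $\delta\in\Delta$ there is a feasible solution of the augmented program whose objective value is at least the expected total reward of $\delta$), and $v_M^*$ is at most the optimal value of the augmented program. (ii) There exist a decomposable POMDP and a feasible solution of (LP) that does not satisfy (C), i.e. for which no values $(\tau_{s'a'soa}^{t,m})$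 satisfy (C) for all $m\in[M]$, $2\le t\le T$.
   Context: Notation: $[N]=\{1,\dots,N\}$. A decomposable POMDP with $M$ components and horizon $T$ consists of finite nonempty sets $\mathcal{X}_S^m,\mathcal{X}_O^m$ ($m\in[M]$) and $\mathcal{X}_A$, initial distributions $p_m(s)$ on $\mathcal{X}_S^m$, emission probabilities $p_m(o|s)$, transition probabilities $p_m(s'|s,a)$, and rewards $r_m:\mathcal{X}_S^m\times\mathcal{X}_A\times\mathcal{X}_S^m\to\mathbb{R}$. The system has state space $\mathcal{X}_S=\prod_m\mathcal{X}_S^m$, observation space $\mathcal{X}_O=\prod_m\mathcal{X}_O^m$, and $\mathbb{P}(\mathbf{S}_1=\mathbf{s})=\prod_m p_m(s^m)$, $\mathbb{P}(\mathbf{O}_t=\mathbf{o}|\mathbf{S}_t=\mathbf{s})=\prod_m p_m(o^m|s^m)$, $\mathbb{P}(\mathbf{S}_{t+1}=\mathbf{s}'|\mathbf{S}_t=\mathbf{s},A_t=a)=\prod_m p_m(s'^m|s^m,a)$, where $\mathbf{S}_t=(S_t^1,\dots,S_t^M)$, $\mathbf{O}_t=(O_t^1,\dots,O_t^M)$. $p_m(s|s',a',o)=\mathbb{P}(S_t^m=s\mid S_{t-1}^m=s',A_{t-1}=a',O_t^m=o)=\dfrac{p_m(o|s)p_m(s|s',a')}{\sum_{\bar s\in\mathcal{X}_S^m}p_m(o|\bar s)p_m(\bar s|s',a')}$ (with an arbitrary fixed value when the denominator is $0$). Policies: $\Delta=\{\delta=(\delta^t_{a|\mathbf{o}}):\ \sum_{a\in\mathcal{X}_A}\delta^t_{a|\mathbf{o}}=1,\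 \delta^t_{a|\mathbf{o}}\ge 0\ \forall \mathbf{o}\in\mathcal{X}_O,a\in\mathcal{X}_A,t\in[T]\}$. Under $\mathbb{P}_\delta$ (expectation $\mathbb{E}_\delta$), at each $t\in[T]$ the action $A_t$ is drawn from $\delta^t_{\cdot|\mathbf{O}_t}$. (LP): over variables $\tau=\big(((\tau_s^{t,m})_s,(\tau_{sa}^{t,m})_{s,a},(\tau_{soa}^{t,m})_{s,o,a})_{m\in[M]},(\tau_a^t)_a\big)_t$ (with $\tau_s^{t,m}$ for $t\in[T+1]$ and the others for $t\in[T]$; $s\in\mathcal{X}_S^m$, $o\in\mathcal{X}_O^m$, $a\in\mathcal{X}_A$), maximize $\sum_{t=1}^T\sum_{m=1}^M\sum_{s,s'\in\mathcal{X}_S^m,\,a\in\mathcal{X}_A}r_m(s,a,s')\,p_m(s'|s,a)\,\tau_{sa}^{t,m}$ subject to, for all $m\in[M]$, $t\in[T]$, $s,s'\in\mathcal{X}_S^m$, $o\in\mathcal{X}_O^m$, $a\in\mathcal{X}_A$: - $\tau_{s'}^{t+1,m}=\sum_{s\in\mathcal{X}_S^m,a\in\mathcal{X}_A}p_m(s'|s,a)\tau_{sa}^{t,m}$; - $\tau_{sa}^{t,m}=\sum_{o\in\mathcal{X}_O^m}\tau_{soa}^{t,m}$; - $\sum_{s\in\mathcal{X}_S^m}\tau_{sa}^{t,m}=\tau_a^t$; - $\sum_{a\in\mathcal{X}_A}\tau_{soa}^{t,m}=p_m(o|s)\tau_s^{t,m}$; - $\tau_s^{1,m}=p_m(s)$;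 - $\tau\ge 0$. *)

theory Defs
  imports "HOL-Probability.Probability"
begin

text \<open>
  Components are indexed by \<open>m \<in> {1..M}\<close>, and the component spaces are carrier sets that may
  depend on \<open>m\<close>. Values of the fields at indices outside \<open>{1..M}\<close> and of the kernels outside the
  carriers are irrelevant.
\<close>

record ('s, 'o, 'a) dpomdp =
  n_comp :: nat
  horizon :: nat
  states :: "nat \<Rightarrow> 's set"
  observations :: "nat \<Rightarrow> 'o set"
  actions :: "'a set"
  init :: "nat \<Rightarrow> 's pmf"
  emission :: "nat \<Rightarrow> 's \<Rightarrow> 'o pmf"
  transition :: "nat \<Rightarrow> 's \<Rightarrow> 'a \<Rightarrow> 's pmf"
  reward :: "nat \<Rightarrow> 's \<Rightarrow> 'a \<Rightarrow> 's \<Rightarrow> real"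

definition decomposable_pomdp :: "('s, 'o, 'a) dpomdp \<Rightarrow> bool" where
  "decomposable_pomdp P \<longleftrightarrow>
     n_comp P \<ge> 1 \<and> horizon P \<ge> 1 \<and>
     finite (actions P) \<and> actions P \<noteq> {} \<and>
     (\<forall>m\<in>{1..n_comp P}.
        finite (states P m) \<and> states P m \<noteq> {} \<and>
        finite (observations P m) \<and> observations P m \<noteq> {} \<and>
        set_pmf (init P m) \<subseteq> states P m \<and>
        (\<forall>s\<in>states P m. set_pmf (emission P m s) \<subseteq> observations P m) \<and>
        (\<forall>s\<in>states P m. \<forall>a\<in>actions P. set_pmf (transition P m s a) \<subseteq> states P m))"

text \<open>
  Elements of the product spaces are extensional functions on \<open>{1..M}\<close>; the default value
  \<open>undefined\<close> makes the product distributions live on \<open>PiE\<close>.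
\<close>

definition joint_observations :: "('s, 'o, 'a) dpomdp \<Rightarrow> (nat \<Rightarrow> 'o) set" where
  "joint_observations P = (\<Pi>\<^sub>E m\<in>{1..n_comp P}. observations P m)"

definition joint_init :: "('s, 'o, 'a) dpomdp \<Rightarrow> (nat \<Rightarrow> 's) pmf" where
  "joint_init P = Pi_pmf {1..n_comp P} undefined (init P)"

definition joint_emission :: "('s, 'o, 'a) dpomdp \<Rightarrow> (nat \<Rightarrow> 's) \<Rightarrow> (nat \<Rightarrow> 'o) pmf" where
  "joint_emission P s = Pi_pmf {1..n_comp P} undefined (\<lambda>m. emission P m (s m))"

definition joint_transition ::
  "('s, 'o, 'a) dpomdp \<Rightarrow> (nat \<Rightarrow> 's) \<Rightarrow> 'a \<Rightarrow> (nat \<Rightarrow> 's) pmf" where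
  "joint_transition P s a = Pi_pmf {1..n_comp P} undefined (\<lambda>m. transition P m (s m) a)"

type_synonym ('o, 'a) policy = "nat \<Rightarrow> (nat \<Rightarrow> 'o) \<Rightarrow> 'a \<Rightarrow> real"

definition policies :: "('s, 'o, 'a) dpomdp \<Rightarrow> ('o, 'a) policy set" where
  "policies P = {\<delta>. \<forall>t\<in>{1..horizon P}. \<forall>ob\<in>joint_observations P.
     (\<Sum>a\<in>actions P. \<delta> t ob a) = 1 \<and> (\<forall>a\<in>actions P. \<delta> t ob a \<ge> 0)}"

definition action_law ::
  "('s, 'o, 'a) dpomdp \<Rightarrow> ('o, 'a) policy \<Rightarrow> nat \<Rightarrow> (nat \<Rightarrow> 'o) \<Rightarrow> 'a pmf" where
  "action_law P \<delta> t ob = embed_pmf (\<lambda>a. if a \<in> actions P then \<delta> t ob a else 0)"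

text \<open>
  A trajectory consists of the processes \<open>S\<close>, \<open>O\<close>, \<open>A\<close> as functions of time. The distribution
  \<open>trajectory_law P \<delta> n\<close> has revealed \<open>S\<close> at times \<open>1..n+1\<close> and \<open>O\<close>, \<open>A\<close> at times \<open>1..n\<close>;
  all other entries are still \<open>undefined\<close>.
\<close>

type_synonym ('s, 'o, 'a) trajectory =
  "(nat \<Rightarrow> nat \<Rightarrow> 's) \<times> (nat \<Rightarrow> nat \<Rightarrow> 'o) \<times> (nat \<Rightarrow> 'a)"

primrec trajectory_law ::
  "('s, 'o, 'a) dpomdp \<Rightarrow> ('o, 'a) policy \<Rightarrow> nat \<Rightarrow> ('s, 'o, 'a) trajectory pmf" where
  "trajectory_law P \<delta> 0 =
     map_pmf (\<lambda>s. ((\<lambda>_. undefined)(1 := s), \<lambda>_. undefined, \<lambda>_. undefined)) (joint_init P)"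
| "trajectory_law P \<delta> (Suc n) =
     bind_pmf (trajectory_law P \<delta> n) (\<lambda>(S, Ob, A).
     bind_pmf (joint_emission P (S (Suc n))) (\<lambda>ob.
     bind_pmf (action_law P \<delta> (Suc n) ob) (\<lambda>a.
     bind_pmf (joint_transition P (S (Suc n)) a) (\<lambda>s'.
     return_pmf (S(Suc (Suc n) := s'), Ob(Suc n := ob), A(Suc n := a))))))"

definition expected_reward :: "('s, 'o, 'a) dpomdp \<Rightarrow> ('o, 'a) policy \<Rightarrow> real" where
  "expected_reward P \<delta> =
     measure_pmf.expectation (trajectory_law P \<delta> (horizon P))
       (\<lambda>(S, Ob, A). \<Sum>t\<in>{1..horizon P}. \<Sum>m\<in>{1..n_comp P}. reward P m (S t m) (A t) (S (t + 1) m))"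

definition memoryless_value :: "('s, 'o, 'a) dpomdp \<Rightarrow> ereal" where
  "memoryless_value P = (SUP \<delta>\<in>policies P. ereal (expected_reward P \<delta>))"

text \<open>The arguments of the variables are ordered as time, component, and then the subscripts.\<close>

record ('s, 'o, 'a) lp_vars =
  tau_s :: "nat \<Rightarrow> nat \<Rightarrow> 's \<Rightarrow> real"
  tau_sa :: "nat \<Rightarrow> nat \<Rightarrow> 's \<Rightarrow> 'a \<Rightarrow> real"
  tau_soa :: "nat \<Rightarrow> nat \<Rightarrow> 's \<Rightarrow> 'o \<Rightarrow> 'a \<Rightarrow> real"
  tau_a :: "nat \<Rightarrow> 'a \<Rightarrow> real"

definition lp_nonneg :: "('s, 'o, 'a) dpomdp \<Rightarrow> ('s, 'o, 'a) lp_vars \<Rightarrow> bool" where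
  "lp_nonneg P \<tau> \<longleftrightarrow>
     (\<forall>t\<in>{1..horizon P + 1}. \<forall>m\<in>{1..n_comp P}. \<forall>s\<in>states P m. tau_s \<tau> t m s \<ge> 0) \<and>
     (\<forall>t\<in>{1..horizon P}.
        (\<forall>a\<in>actions P. tau_a \<tau> t a \<ge> 0) \<and>
        (\<forall>m\<in>{1..n_comp P}. \<forall>s\<in>states P m. \<forall>a\<in>actions P.
           tau_sa \<tau> t m s a \<ge> 0 \<and>
           (\<forall>ob\<in>observations P m. tau_soa \<tau> t m s ob a \<ge> 0)))"

definition lp_feasible :: "('s, 'o, 'a) dpomdp \<Rightarrow> ('s, 'o, 'a) lp_vars \<Rightarrow> bool" where
  "lp_feasible P \<tau> \<longleftrightarrow>
     (\<forall>m\<in>{1..n_comp P}. \<forall>t\<in>{1..horizon P}.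
        (\<forall>s'\<in>states P m. tau_s \<tau> (t + 1) m s' =
           (\<Sum>s\<in>states P m. \<Sum>a\<in>actions P. pmf (transition P m s a) s' * tau_sa \<tau> t m s a)) \<and>
        (\<forall>s\<in>states P m. \<forall>a\<in>actions P. tau_sa \<tau> t m s a =
           (\<Sum>ob\<in>observations P m. tau_soa \<tau> t m s ob a)) \<and>
        (\<forall>a\<in>actions P. (\<Sum>s\<in>states P m. tau_sa \<tau> t m s a) = tau_a \<tau> t a) \<and>
        (\<forall>s\<in>states P m. \<forall>ob\<in>observations P m. (\<Sum>a\<in>actions P. tau_soa \<tau> t m s ob a) =
           pmf (emission P m s) ob * tau_s \<tau> t m s)) \<and>
     (\<forall>m\<in>{1..n_comp P}. \<forall>s\<in>states P m. tau_s \<tau> 1 m s = pmf (init P m) s) \<and>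
     lp_nonneg P \<tau>"

definition lp_objective :: "('s, 'o, 'a) dpomdp \<Rightarrow> ('s, 'o, 'a) lp_vars \<Rightarrow> real" where
  "lp_objective P \<tau> =
     (\<Sum>t\<in>{1..horizon P}. \<Sum>m\<in>{1..n_comp P}.
        \<Sum>s\<in>states P m. \<Sum>s'\<in>states P m. \<Sum>a\<in>actions P.
          reward P m s a s' * pmf (transition P m s a) s' * tau_sa \<tau> t m s a)"

text \<open>
  The conditional probability \<open>p\<^sub>m(s | s', a', o)\<close>, where the parameter \<open>c\<close> supplies the
  arbitrary values used when the conditioning event has probability zero.
\<close>

definition posterior ::
  "('s, 'o, 'a) dpomdp \<Rightarrow> (nat \<Rightarrow> 's \<Rightarrow> 's \<Rightarrow> 'a \<Rightarrow> 'o \<Rightarrow> real) \<Rightarrow>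
   nat \<Rightarrow> 's \<Rightarrow> 's \<Rightarrow> 'a \<Rightarrow> 'o \<Rightarrow> real" where
  "posterior P c m s s' a' ob =
     (let d = (\<Sum>sb\<in>states P m. pmf (emission P m sb) ob * pmf (transition P m s' a') sb)
      in if d = 0 then c m s s' a' ob
         else pmf (emission P m s) ob * pmf (transition P m s' a') s / d)"

text \<open>The additional variables \<open>\<sigma> t m s' a' s o a\<close> are not sign-constrained.\<close>

type_synonym ('s, 'o, 'a) ext_vars = "nat \<Rightarrow> nat \<Rightarrow> 's \<Rightarrow> 'a \<Rightarrow> 's \<Rightarrow> 'o \<Rightarrow> 'a \<Rightarrow> real"

definition extra_equalities ::
  "('s, 'o, 'a) dpomdp \<Rightarrow> (nat \<Rightarrow> 's \<Rightarrow> 's \<Rightarrow> 'a \<Rightarrow> 'o \<Rightarrow> real) \<Rightarrow>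
   ('s, 'o, 'a) lp_vars \<Rightarrow> ('s, 'o, 'a) ext_vars \<Rightarrow> bool" where
  "extra_equalities P c \<tau> \<sigma> \<longleftrightarrow>
     (\<forall>m\<in>{1..n_comp P}. \<forall>t\<in>{2..horizon P}.
        (\<forall>s\<in>states P m. \<forall>ob\<in>observations P m. \<forall>a\<in>actions P.
           (\<Sum>s'\<in>states P m. \<Sum>a'\<in>actions P. \<sigma> t m s' a' s ob a) = tau_soa \<tau> t m s ob a) \<and>
        (\<forall>s\<in>states P m. \<forall>s'\<in>states P m. \<forall>ob\<in>observations P m. \<forall>a'\<in>actions P.
           (\<Sum>a\<in>actions P. \<sigma> t m s' a' s ob a) =
             pmf (emission P m s) ob * pmf (transition P m s' a') s * tau_sa \<tau> (t - 1) m s' a') \<and>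
        (\<forall>s\<in>states P m. \<forall>s'\<in>states P m. \<forall>ob\<in>observations P m. \<forall>a\<in>actions P. \<forall>a'\<in>actions P.
           \<sigma> t m s' a' s ob a =
             posterior P c m s s' a' ob * (\<Sum>sb\<in>states P m. \<sigma> t m s' a' sb ob a)))"

definition augmented_feasible ::
  "('s, 'o, 'a) dpomdp \<Rightarrow> (nat \<Rightarrow> 's \<Rightarrow> 's \<Rightarrow> 'a \<Rightarrow> 'o \<Rightarrow> real) \<Rightarrow>
   (('s, 'o, 'a) lp_vars \<times> ('s, 'o, 'a) ext_vars) set" where
  "augmented_feasible P c = {(\<tau>, \<sigma>). lp_feasible P \<tau> \<and> extra_equalities P c \<tau> \<sigma>}"

definition augmented_value ::
  "('s, 'o, 'a) dpomdp \<Rightarrow> (nat \<Rightarrow> 's \<Rightarrow> 's \<Rightarrow> 'a \<Rightarrow> 'o \<Rightarrow> real) \<Rightarrow> ereal" where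
  "augmented_value P c = (SUP (\<tau>, \<sigma>)\<in>augmented_feasible P c. ereal (lp_objective P \<tau>))"

end

theory Submission
  imports Defs
begin

text \<open>
  The relaxation part holds because every memoryless policy \<open>\<delta>\<close> induces a feasible point of the
  augmented program whose objective is exactly the expected reward of \<open>\<delta>\<close>: let every \<open>\<tau>\<close> be the
  probability, under \<open>\<delta>\<close>, of the event that its subscripts describe, and let \<open>\<sigma>\<close> be the joint
  probability of \<open>(S\<^sub>t\<^sub>-\<^sub>1\<^sup>m, A\<^sub>t\<^sub>-\<^sub>1, S\<^sub>t\<^sup>m, O\<^sub>t\<^sup>m, A\<^sub>t)\<close>. The constraints of the linear program and the first two
  families of extra equalities then say how marginals of these laws are related.

  The third family is a conditional independence statement: given \<open>S\<^sub>t\<^sub>-\<^sub>1\<^sup>m\<close>, \<open>A\<^sub>t\<^sub>-\<^sub>1\<close> and \<open>O\<^sub>t\<^sup>m\<close>, the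
  action \<open>A\<^sub>t\<close> carries no further information about \<open>S\<^sub>t\<^sup>m\<close>. Indeed, given the whole previous state and
  action, the pairs \<open>(S\<^sub>t\<^sup>k, O\<^sub>t\<^sup>k)\<close> are independent over the components \<open>k\<close>, and a memoryless policy
  sees the state of component \<open>m\<close> only through \<open>O\<^sub>t\<^sup>m\<close> (lemma \<open>split_component\<close>). Averaging over the
  previous state yields \<open>\<sigma> = p\<^sub>m(o | s) p\<^sub>m(s | s', a') w\<close> with \<open>w\<close> independent of \<open>s\<close>
  (lemma \<open>policy_ext_factors\<close>), and normalising over \<open>s\<close> gives the posterior. This product form also
  settles the case in which the posterior has denominator \<open>0\<close>: both sides vanish, whatever the
  arbitrary values are.

  The strictness part uses components whose state is a fresh fair coin at every time and whose
  observation is constant. The plain linear program lets the action copy the hidden coin, since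
  none of its constraints ties the action to what the observation reveals about the state. The extra
  equalities force \<open>\<sigma>\<close>, and hence \<open>\<tau>\<^sub>s\<^sub>o\<^sub>a\<close>, to be independent of the coin from time \<open>2\<close> on.
\<close>

section \<open>Marginals of finitely supported distributions\<close>

text \<open>
  Every marginal constraint is an instance: \<open>h\<close> inserts a summation variable and \<open>f\<close> forgets it.
\<close>

lemma sum_pmf_eq_pmf_map:
  assumes "finite A" and "inj_on h A" and "\<And>x. x \<in> A \<Longrightarrow> f (h x) = y"
    and "\<And>z. z \<in> set_pmf Q \<Longrightarrow> f z = y \<Longrightarrow> z \<in> h ` A"
  shows "(\<Sum>x\<in>A. pmf Q (h x)) = pmf (map_pmf f Q) y"
proof -
  have "pmf (map_pmf f Q) y = measure_pmf.prob Q (f -` {y})"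
    by (simp add: pmf_map)
  also have "\<dots> = measure_pmf.prob Q (h ` A)"
    using assms(3,4) by (intro measure_pmf.finite_measure_eq_AE) (auto simp: AE_measure_pmf_iff)
  also have "\<dots> = sum (pmf Q) (h ` A)"
    using assms(1) by (simp add: measure_measure_pmf_finite)
  also have "\<dots> = (\<Sum>x\<in>A. pmf Q (h x))"
    using assms(2) by (simp add: sum.reindex)
  finally show ?thesis by simp
qed

text \<open>
  The multiplication rule \<open>P(X = x, Y = y) = P(X = x) P(Y = y | X = x)\<close>. It turns the equalities
  between laws below into the products of kernels that appear in the constraints.
\<close>

lemma pmf_bind_tagged:
  "pmf (bind_pmf Q (\<lambda>x. map_pmf (Pair x) (K x))) (x, y) = pmf Q x * pmf (K x) y"
proof -
  have "pmf (map_pmf (Pair z) (K z)) (x, y) = indicator {x} z * pmf (K x) y" for z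
    by (cases "z = x") (auto simp: pmf_map_inj' inj_on_def pmf_eq_0_set_pmf)
  then show ?thesis
    by (simp add: pmf_bind measure_pmf_single)
qed

lemma set_Pi_pmf_subset_PiE:
  assumes "finite I" and "\<And>i. i \<in> I \<Longrightarrow> set_pmf (p i) \<subseteq> A i"
  shows "set_pmf (Pi_pmf I undefined p) \<subseteq> (\<Pi>\<^sub>E i\<in>I. A i)"
  using assms by (fastforce simp: set_Pi_pmf PiE_dflt_def PiE_def extensional_def)

section \<open>The chain of states, observations and actions under a memoryless policy\<close>

definition joint_states :: "('s, 'o, 'a) dpomdp \<Rightarrow> (nat \<Rightarrow> 's) set" where
  "joint_states P = (\<Pi>\<^sub>E m\<in>{1..n_comp P}. states P m)"

definition observe_act ::
  "('s, 'o, 'a) dpomdp \<Rightarrow> ('o, 'a) policy \<Rightarrow> nat \<Rightarrow> (nat \<Rightarrow> 's) \<Rightarrow> ((nat \<Rightarrow> 'o) \<times> 'a) pmf" where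
  "observe_act P \<delta> t x =
     bind_pmf (joint_emission P x) (\<lambda>ob. map_pmf (Pair ob) (action_law P \<delta> t ob))"

text \<open>
  By time \<open>t - 1\<close> a trajectory has just revealed its state at time \<open>t\<close>, so this is the law of \<open>S\<^sub>t\<close>
  for every \<open>t \<ge> 1\<close>.
\<close>

definition state_law ::
  "('s, 'o, 'a) dpomdp \<Rightarrow> ('o, 'a) policy \<Rightarrow> nat \<Rightarrow> (nat \<Rightarrow> 's) pmf" where
  "state_law P \<delta> t = map_pmf (\<lambda>(S, _, _). S t) (trajectory_law P \<delta> (t - 1))"

text \<open>The law of \<open>(S\<^sub>t, O\<^sub>t, A\<^sub>t)\<close> on the joint spaces.\<close>

definition decision_law ::
  "('s, 'o, 'a) dpomdp \<Rightarrow> ('o, 'a) policy \<Rightarrow> nat \<Rightarrow> ((nat \<Rightarrow> 's) \<times> (nat \<Rightarrow> 'o) \<times> 'a) pmf" where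
  "decision_law P \<delta> t = bind_pmf (state_law P \<delta> t) (\<lambda>x. map_pmf (Pair x) (observe_act P \<delta> t x))"

text \<open>
  The law of \<open>(S\<^sub>t\<^sub>-\<^sub>1\<^sup>m, A\<^sub>t\<^sub>-\<^sub>1, S\<^sub>t\<^sup>m, O\<^sub>t\<^sup>m, A\<^sub>t)\<close>. The joint states are sampled in full and projected to
  component \<open>m\<close> only at the end, because \<open>A\<^sub>t\<close> depends on the observations of all components.
\<close>

definition window_law ::
  "('s, 'o, 'a) dpomdp \<Rightarrow> ('o, 'a) policy \<Rightarrow> nat \<Rightarrow> nat \<Rightarrow> ('s \<times> 'a \<times> 's \<times> 'o \<times> 'a) pmf" where
  "window_law P \<delta> t m =
     bind_pmf (decision_law P \<delta> (t - 1)) (\<lambda>(x, _, a').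
     bind_pmf (joint_transition P x a') (\<lambda>y.
     map_pmf (\<lambda>(ob, a). (x m, a', y m, ob m, a)) (observe_act P \<delta> t y)))"

lemma state_law_1: "state_law P \<delta> 1 = joint_init P"
  by (simp add: state_law_def map_pmf_comp)

lemma trajectory_law_step:
  "map_pmf (\<lambda>(S, Ob, A). (S (Suc n), Ob (Suc n), A (Suc n), S (Suc (Suc n))))
     (trajectory_law P \<delta> (Suc n)) =
   bind_pmf (decision_law P \<delta> (Suc n)) (\<lambda>(x, ob, a).
     map_pmf (\<lambda>y. (x, ob, a, y)) (joint_transition P x a))"
  by (simp add: decision_law_def state_law_def observe_act_def map_bind_pmf bind_map_pmf
      bind_assoc_pmf map_pmf_comp case_prod_unfold) (simp add: map_pmf_def)

lemma state_law_Suc: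
  assumes "t \<ge> 1"
  shows "state_law P \<delta> (Suc t) =
     bind_pmf (decision_law P \<delta> t) (\<lambda>(x, _, a). joint_transition P x a)"
proof -
  obtain n where t: "t = Suc n" using assms by (cases t) auto
  have "state_law P \<delta> (Suc t) = map_pmf (\<lambda>(x, ob, a, y). y)
    (map_pmf (\<lambda>(S, Ob, A). (S (Suc n), Ob (Suc n), A (Suc n), S (Suc (Suc n))))
     (trajectory_law P \<delta> (Suc n)))"
    unfolding t state_law_def map_pmf_comp by (simp add: case_prod_unfold)
  then show ?thesis
    unfolding trajectory_law_step t
    by (simp add: map_bind_pmf map_pmf_comp case_prod_unfold map_pmf_ident)
qed

text \<open>
  Steps after time \<open>t\<close> only write entries with index larger than \<open>t\<close> (larger than \<open>t + 1\<close> for the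
  states), so one transition can be read off the full trajectory as if the process stopped there.
\<close>

lemma trajectory_law_transition:
  assumes "1 \<le> t" and "t \<le> n"
  shows "map_pmf (\<lambda>(S, Ob, A). (S t, Ob t, A t, S (Suc t))) (trajectory_law P \<delta> n) =
    bind_pmf (decision_law P \<delta> t) (\<lambda>(x, ob, a).
      map_pmf (\<lambda>y. (x, ob, a, y)) (joint_transition P x a))"
  using assms(2)
proof (induction n rule: dec_induct)
  case base
  obtain k where "t = Suc k" using assms(1) by (cases t) auto
  then show ?case by (simp only: trajectory_law_step)
next
  case (step n)
  have "map_pmf (\<lambda>(S, Ob, A). (S t, Ob t, A t, S (Suc t))) (trajectory_law P \<delta> (Suc n)) =
    map_pmf (\<lambda>(S, Ob, A). (S t, Ob t, A t, S (Suc t))) (trajectory_law P \<delta> n)"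
    using step(1) by (simp add: map_bind_pmf case_prod_unfold) (simp add: map_pmf_def)
  then show ?case using step.IH by simp
qed

locale controlled_pomdp =
  fixes P :: "('s, 'o, 'a) dpomdp" and \<delta> :: "('o, 'a) policy"
  assumes decomposable: "decomposable_pomdp P" and policy: "\<delta> \<in> policies P"
begin

lemma finite_states: "m \<in> {1..n_comp P} \<Longrightarrow> finite (states P m)"
  and finite_observations: "m \<in> {1..n_comp P} \<Longrightarrow> finite (observations P m)"
  and finite_actions: "finite (actions P)"
  using decomposable by (auto simp: decomposable_pomdp_def)

lemma set_emission:
  "m \<in> {1..n_comp P} \<Longrightarrow> s \<in> states P m \<Longrightarrow> set_pmf (emission P m s) \<subseteq> observations P m"
  using decomposable by (auto simp: decomposable_pomdp_def)

lemma set_transition: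
  "m \<in> {1..n_comp P} \<Longrightarrow> s \<in> states P m \<Longrightarrow> a \<in> actions P \<Longrightarrow>
     set_pmf (transition P m s a) \<subseteq> states P m"
  using decomposable by (auto simp: decomposable_pomdp_def)

lemma joint_states_component: "x \<in> joint_states P \<Longrightarrow> m \<in> {1..n_comp P} \<Longrightarrow> x m \<in> states P m"
  by (auto simp: joint_states_def)

lemma joint_observations_component:
  "x \<in> joint_observations P \<Longrightarrow> m \<in> {1..n_comp P} \<Longrightarrow> x m \<in> observations P m"
  by (auto simp: joint_observations_def)

lemma finite_joint_states: "finite (joint_states P)"
  unfolding joint_states_def by (intro finite_PiE finite_states) auto

lemma finite_joint_observations: "finite (joint_observations P)"
  unfolding joint_observations_def by (intro finite_PiE finite_observations) auto

lemma set_joint_init: "set_pmf (joint_init P) \<subseteq> joint_states P"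
  using decomposable unfolding joint_init_def joint_states_def decomposable_pomdp_def
  by (intro set_Pi_pmf_subset_PiE) auto

lemma set_joint_emission:
  "x \<in> joint_states P \<Longrightarrow> set_pmf (joint_emission P x) \<subseteq> joint_observations P"
  unfolding joint_emission_def joint_observations_def
  by (intro set_Pi_pmf_subset_PiE set_emission joint_states_component) auto

lemma set_joint_transition:
  "x \<in> joint_states P \<Longrightarrow> a \<in> actions P \<Longrightarrow> set_pmf (joint_transition P x a) \<subseteq> joint_states P"
  unfolding joint_transition_def joint_states_def[where P = P]
  by (intro set_Pi_pmf_subset_PiE set_transition) auto

lemma set_action_law:
  assumes "t \<in> {1..horizon P}" and "ob \<in> joint_observations P"
  shows "set_pmf (action_law P \<delta> t ob) \<subseteq> actions P"
proof -
  let ?f = "\<lambda>a. if a \<in> actions P then \<delta> t ob a else 0"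
  have nonneg: "?f a \<ge> 0" for a
    using policy assms by (auto simp: policies_def)
  have "(\<integral>\<^sup>+ a. ennreal (?f a) \<partial>count_space UNIV) = (\<Sum>a\<in>actions P. ennreal (?f a))"
    by (rule nn_integral_count_space'[OF finite_actions]) auto
  also have "\<dots> = ennreal (\<Sum>a\<in>actions P. ?f a)"
    using nonneg by (rule sum_ennreal)
  also have "(\<Sum>a\<in>actions P. ?f a) = 1"
    using policy assms by (auto simp: policies_def)
  finally have "set_pmf (embed_pmf ?f) = {a. ?f a \<noteq> 0}"
    using nonneg by (intro set_embed_pmf) auto
  then show ?thesis
    by (auto simp: action_law_def)
qed

lemma set_observe_act:
  "t \<in> {1..horizon P} \<Longrightarrow> x \<in> joint_states P \<Longrightarrow>
     set_pmf (observe_act P \<delta> t x) \<subseteq> joint_observations P \<times> actions P"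
  using set_action_law set_joint_emission by (fastforce simp: observe_act_def)

lemma set_trajectory_law:
  "n \<le> horizon P \<Longrightarrow> finite (set_pmf (trajectory_law P \<delta> n)) \<and>
     (\<forall>(S, Ob, A) \<in> set_pmf (trajectory_law P \<delta> n). S (Suc n) \<in> joint_states P)"
proof (induction n)
  case 0
  then show ?case
    using set_joint_init finite_subset[OF set_joint_init finite_joint_states] by auto
next
  case (Suc n)
  have *: "finite (set_pmf (joint_emission P x))"
    "ob \<in> set_pmf (joint_emission P x) \<Longrightarrow> finite (set_pmf (action_law P \<delta> (Suc n) ob))"
    "ob \<in> set_pmf (joint_emission P x) \<Longrightarrow> a \<in> set_pmf (action_law P \<delta> (Suc n) ob) \<Longrightarrow>
      finite (set_pmf (joint_transition P x a)) \<and> set_pmf (joint_transition P x a) \<subseteq> joint_states P"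
    if "x \<in> joint_states P" for x ob a
  proof -
    have t: "Suc n \<in> {1..horizon P}" using Suc.prems by auto
    show "finite (set_pmf (joint_emission P x))"
      using set_joint_emission[OF that] finite_joint_observations by (rule finite_subset)
    assume "ob \<in> set_pmf (joint_emission P x)"
    then have ob: "ob \<in> joint_observations P" using set_joint_emission[OF that] by auto
    show "finite (set_pmf (action_law P \<delta> (Suc n) ob))"
      using set_action_law[OF t ob] finite_actions by (rule finite_subset)
    assume "a \<in> set_pmf (action_law P \<delta> (Suc n) ob)"
    then have "a \<in> actions P" using set_action_law[OF t ob] by auto
    from set_joint_transition[OF that this]
    show "finite (set_pmf (joint_transition P x a)) \<and>
        set_pmf (joint_transition P x a) \<subseteq> joint_states P"
      using finite_joint_states by (auto intro: finite_subset)
  qed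
  \<comment> \<open>The last revealed state lies in the carrier, so each of the three draws has finite support.\<close>
  show ?case
    using Suc * by (fastforce simp: case_prod_unfold)
qed

lemma set_state_law:
  assumes "t \<in> {1..Suc (horizon P)}"
  shows "set_pmf (state_law P \<delta> t) \<subseteq> joint_states P"
  using set_trajectory_law[of "t - 1"] assms by (fastforce simp: state_law_def)

text \<open>
  The constraints sum over the carriers only; these sums exhaust the probability mass because the
  chain never leaves the carriers.
\<close>

lemma set_decision_law:
  assumes "t \<in> {1..horizon P}"
  shows "set_pmf (decision_law P \<delta> t) \<subseteq> joint_states P \<times> joint_observations P \<times> actions P"
  using set_observe_act[OF assms] set_state_law[of t] assms
  by (fastforce simp: decision_law_def)

lemma set_window_law:
  assumes m: "m \<in> {1..n_comp P}" and t: "t \<in> {2..horizon P}"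
  shows "set_pmf (window_law P \<delta> t m) \<subseteq>
    states P m \<times> actions P \<times> states P m \<times> observations P m \<times> actions P"
proof
  fix z assume "z \<in> set_pmf (window_law P \<delta> t m)"
  then obtain x ob' a' y ob a where z: "z = (x m, a', y m, ob m, a)"
    and d: "(x, ob', a') \<in> set_pmf (decision_law P \<delta> (t - 1))"
    and y: "y \<in> set_pmf (joint_transition P x a')"
    and o: "(ob, a) \<in> set_pmf (observe_act P \<delta> t y)"
    by (auto simp: window_law_def)
  from t have t': "t - 1 \<in> {1..horizon P}" "t \<in> {1..horizon P}" by auto
  from set_decision_law[OF t'(1)] d have x: "x \<in> joint_states P" and a': "a' \<in> actions P"
    by auto
  with set_joint_transition y have y: "y \<in> joint_states P" by blast
  with set_observe_act[OF t'(2)] o have "ob \<in> joint_observations P" "a \<in> actions P" by blast+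
  with x a' y m show "z \<in> states P m \<times> actions P \<times> states P m \<times> observations P m \<times> actions P"
    by (simp add: z joint_states_component joint_observations_component)
qed

section \<open>The linear program variables of a policy\<close>

definition policy_vars :: "('s, 'o, 'a) lp_vars" where
  "policy_vars =
    \<lparr> tau_s = \<lambda>t m. pmf (map_pmf (\<lambda>x. x m) (state_law P \<delta> t)),
      tau_sa = \<lambda>t m s a. pmf (map_pmf (\<lambda>(x, _, a). (x m, a)) (decision_law P \<delta> t)) (s, a),
      tau_soa = \<lambda>t m s ob a.
        pmf (map_pmf (\<lambda>(x, ob, a). (x m, ob m, a)) (decision_law P \<delta> t)) (s, ob, a),
      tau_a = \<lambda>t. pmf (map_pmf (\<lambda>(_, _, a). a) (decision_law P \<delta> t)) \<rparr>"

definition policy_ext :: "('s, 'o, 'a) ext_vars" where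
  "policy_ext t m s' a' s ob a = pmf (window_law P \<delta> t m) (s', a', s, ob, a)"

lemma map_joint_init: "m \<in> {1..n_comp P} \<Longrightarrow> map_pmf (\<lambda>x. x m) (joint_init P) = init P m"
  unfolding joint_init_def by (subst Pi_pmf_component) auto

lemma map_joint_emission:
  "m \<in> {1..n_comp P} \<Longrightarrow> map_pmf (\<lambda>ob. ob m) (joint_emission P x) = emission P m (x m)"
  unfolding joint_emission_def by (subst Pi_pmf_component) auto

lemma map_joint_transition:
  "m \<in> {1..n_comp P} \<Longrightarrow> map_pmf (\<lambda>y. y m) (joint_transition P x a) = transition P m (x m) a"
  unfolding joint_transition_def by (subst Pi_pmf_component) auto

text \<open>
  The law of \<open>((S\<^sub>t\<^sup>m, A\<^sub>t), S\<^sub>t\<^sub>+\<^sub>1\<^sup>m)\<close> is a Markov step from the pair \<open>(S\<^sub>t\<^sup>m, A\<^sub>t)\<close> alone, since component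
  \<open>m\<close> of the joint transition depends on the joint state through component \<open>m\<close> only. The flow
  constraint, the objective and the second family of extra equalities all rest on this.
\<close>

lemma tau_sa_transition:
  assumes m: "m \<in> {1..n_comp P}"
  shows "pmf (bind_pmf (decision_law P \<delta> t) (\<lambda>(x, _, a).
      map_pmf (\<lambda>y. ((x m, a), y m)) (joint_transition P x a))) ((s, a), s') =
    tau_sa policy_vars t m s a * pmf (transition P m s a) s'"
proof -
  have "map_pmf (\<lambda>y. ((x m, a), y m)) (joint_transition P x a) =
      map_pmf (Pair (x m, a)) (transition P m (x m) a)" for x a
    by (simp add: map_joint_transition[OF m, symmetric] map_pmf_comp)
  then have "bind_pmf (decision_law P \<delta> t) (\<lambda>(x, _, a).
      map_pmf (\<lambda>y. ((x m, a), y m)) (joint_transition P x a)) =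
    bind_pmf (map_pmf (\<lambda>(x, _, a). (x m, a)) (decision_law P \<delta> t))
      (\<lambda>z. map_pmf (Pair z) (transition P m (fst z) (snd z)))"
    by (simp add: bind_map_pmf case_prod_unfold)
  then show ?thesis
    by (simp add: pmf_bind_tagged policy_vars_def)
qed

lemma policy_vars_lp_feasible: "lp_feasible P policy_vars"
  unfolding lp_feasible_def
proof (intro conjI ballI)
  fix m t s' assume m: "m \<in> {1..n_comp P}" and t: "t \<in> {1..horizon P}" and s': "s' \<in> states P m"
  let ?Q = "bind_pmf (decision_law P \<delta> t) (\<lambda>(x, _, a).
      map_pmf (\<lambda>y. ((x m, a), y m)) (joint_transition P x a))"
  have "(\<Sum>s\<in>states P m. \<Sum>a\<in>actions P. pmf (transition P m s a) s' * tau_sa policy_vars t m s a) =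
    (\<Sum>z\<in>states P m \<times> actions P. pmf ?Q (z, s'))"
    unfolding sum.cartesian_product
    by (intro sum.cong refl) (clarsimp simp: tau_sa_transition[OF m, simplified] mult.commute)
  also have "\<dots> = pmf (map_pmf snd ?Q) s'"
    using finite_states[OF m] finite_actions set_decision_law[OF t] joint_states_component[OF _ m]
    by (intro sum_pmf_eq_pmf_map) (fastforce simp: inj_on_def)+
  also have "map_pmf snd ?Q = map_pmf (\<lambda>x. x m) (state_law P \<delta> (t + 1))"
    using t by (simp add: state_law_Suc map_bind_pmf map_pmf_comp case_prod_unfold)
  finally show "tau_s policy_vars (t + 1) m s' = (\<Sum>s\<in>states P m. \<Sum>a\<in>actions P.
      pmf (transition P m s a) s' * tau_sa policy_vars t m s a)"
    by (simp add: policy_vars_def)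
next
  fix m t s a assume m: "m \<in> {1..n_comp P}" and t: "t \<in> {1..horizon P}"
    and s: "s \<in> states P m" and a: "a \<in> actions P"
  let ?Q = "map_pmf (\<lambda>(x, ob, a). (x m, ob m, a)) (decision_law P \<delta> t)"
  have "(\<Sum>ob\<in>observations P m. pmf ?Q (s, ob, a)) = pmf (map_pmf (\<lambda>(s, ob, a). (s, a)) ?Q) (s, a)"
    using finite_observations[OF m] set_decision_law[OF t] joint_observations_component[OF _ m]
    by (intro sum_pmf_eq_pmf_map) (fastforce simp: inj_on_def)+
  then show "tau_sa policy_vars t m s a = (\<Sum>ob\<in>observations P m. tau_soa policy_vars t m s ob a)"
    by (simp add: policy_vars_def map_pmf_comp case_prod_unfold)
next
  fix m t a assume m: "m \<in> {1..n_comp P}" and t: "t \<in> {1..horizon P}" and a: "a \<in> actions P"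
  let ?Q = "map_pmf (\<lambda>(x, _, a). (x m, a)) (decision_law P \<delta> t)"
  have "(\<Sum>s\<in>states P m. pmf ?Q (s, a)) = pmf (map_pmf snd ?Q) a"
    using finite_states[OF m] set_decision_law[OF t] joint_states_component[OF _ m]
    by (intro sum_pmf_eq_pmf_map) (fastforce simp: inj_on_def)+
  then show "(\<Sum>s\<in>states P m. tau_sa policy_vars t m s a) = tau_a policy_vars t a"
    by (simp add: policy_vars_def map_pmf_comp case_prod_unfold)
next
  fix m t s ob assume m: "m \<in> {1..n_comp P}" and t: "t \<in> {1..horizon P}"
    and s: "s \<in> states P m" and ob: "ob \<in> observations P m"
  let ?Q = "map_pmf (\<lambda>(x, ob, a). (x m, ob m, a)) (decision_law P \<delta> t)"
  have "(\<Sum>a\<in>actions P. pmf ?Q (s, ob, a)) = pmf (map_pmf (\<lambda>(s, ob, a). (s, ob)) ?Q) (s, ob)"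
    using finite_actions set_decision_law[OF t]
    by (intro sum_pmf_eq_pmf_map) (fastforce simp: inj_on_def)+
  also have "map_pmf (\<lambda>(s, ob, a). (s, ob)) ?Q =
    bind_pmf (state_law P \<delta> t) (\<lambda>x. map_pmf (\<lambda>ob. (x m, ob m)) (joint_emission P x))"
    by (simp add: decision_law_def observe_act_def map_bind_pmf map_pmf_comp case_prod_unfold
        map_pmf_const) (simp add: map_pmf_def)
  also have "\<dots> = bind_pmf (map_pmf (\<lambda>x. x m) (state_law P \<delta> t))
      (\<lambda>s. map_pmf (Pair s) (emission P m s))"
    by (simp add: bind_map_pmf map_joint_emission[OF m, symmetric] map_pmf_comp)
  finally show "(\<Sum>a\<in>actions P. tau_soa policy_vars t m s ob a) =
      pmf (emission P m s) ob * tau_s policy_vars t m s"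
    by (simp add: policy_vars_def pmf_bind_tagged)
next
  fix m s assume m: "m \<in> {1..n_comp P}"
  then show "tau_s policy_vars 1 m s = pmf (init P m) s"
    using state_law_1[of P \<delta>] by (simp add: policy_vars_def map_joint_init)
next
  show "lp_nonneg P policy_vars"
    by (simp add: lp_nonneg_def policy_vars_def)
qed

text \<open>
  The reward is a sum of functions of single transitions of single components, so its expectation
  depends on the policy only through the laws of \<open>((S\<^sub>t\<^sup>m, A\<^sub>t), S\<^sub>t\<^sub>+\<^sub>1\<^sup>m)\<close>.
\<close>

lemma lp_objective_policy_vars: "lp_objective P policy_vars = expected_reward P \<delta>"
proof -
  let ?L = "trajectory_law P \<delta> (horizon P)"
  have integrable: "integrable (measure_pmf ?L) g" for g :: "_ \<Rightarrow> real"
    using set_trajectory_law by (intro integrable_measure_pmf_finite) simp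
  have marginal: "measure_pmf.expectation ?L (\<lambda>z. reward P m (fst z t m) (snd (snd z) t) (fst z (t + 1) m))
    = (\<Sum>s\<in>states P m. \<Sum>s'\<in>states P m. \<Sum>a\<in>actions P.
        reward P m s a s' * pmf (transition P m s a) s' * tau_sa policy_vars t m s a)"
    if t: "t \<in> {1..horizon P}" and m: "m \<in> {1..n_comp P}" for t m
  proof -
    let ?Q = "bind_pmf (decision_law P \<delta> t) (\<lambda>(x, _, a).
      map_pmf (\<lambda>y. ((x m, a), y m)) (joint_transition P x a))"
    let ?r = "\<lambda>((s, a), s'). reward P m s a s'"
    let ?J = "(states P m \<times> actions P) \<times> states P m"
    have Q: "?Q = map_pmf (\<lambda>(S, Ob, A). ((S t m, A t), S (t + 1) m)) ?L"
    proof -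
      have "map_pmf (\<lambda>(S, Ob, A). ((S t m, A t), S (t + 1) m)) ?L =
        map_pmf (\<lambda>(x, ob, a, y). ((x m, a), y m))
          (map_pmf (\<lambda>(S, Ob, A). (S t, Ob t, A t, S (Suc t))) ?L)"
        by (simp add: map_pmf_comp case_prod_unfold)
      also have "map_pmf (\<lambda>(S, Ob, A). (S t, Ob t, A t, S (Suc t))) ?L =
        bind_pmf (decision_law P \<delta> t) (\<lambda>(x, ob, a).
          map_pmf (\<lambda>y. (x, ob, a, y)) (joint_transition P x a))"
        using t by (intro trajectory_law_transition) auto
      finally show ?thesis
        by (simp add: map_bind_pmf map_pmf_comp case_prod_unfold)
    qed
    have set_Q: "set_pmf ?Q \<subseteq> ?J"
      using set_decision_law[OF t] set_joint_transition joint_states_component[OF _ m] by fastforce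
    have "measure_pmf.expectation ?L
        (\<lambda>z. reward P m (fst z t m) (snd (snd z) t) (fst z (t + 1) m)) =
      measure_pmf.expectation ?Q ?r"
      unfolding Q by (simp add: case_prod_unfold)
    also have "\<dots> = (\<Sum>z\<in>?J. ?r z * pmf ?Q z)"
      using finite_states[OF m] finite_actions set_Q
      by (intro integral_measure_pmf_real) auto
    also have "\<dots> = (\<Sum>((s, a), s')\<in>?J.
        reward P m s a s' * pmf (transition P m s a) s' * tau_sa policy_vars t m s a)"
      by (intro sum.cong) (auto simp: tau_sa_transition[OF m])
    also have "\<dots> = (\<Sum>s\<in>states P m. \<Sum>a\<in>actions P. \<Sum>s'\<in>states P m.
        reward P m s a s' * pmf (transition P m s a) s' * tau_sa policy_vars t m s a)"
      by (simp add: sum.cartesian_product' case_prod_unfold)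
    also have "\<dots> = (\<Sum>s\<in>states P m. \<Sum>s'\<in>states P m. \<Sum>a\<in>actions P.
        reward P m s a s' * pmf (transition P m s a) s' * tau_sa policy_vars t m s a)"
      by (intro sum.cong refl sum.swap)
    finally show ?thesis .
  qed
  show ?thesis
    unfolding lp_objective_def expected_reward_def case_prod_unfold
    by (simp add: integrable Bochner_Integration.integral_sum marginal[simplified])
qed

section \<open>Conditional independence of state and action\<close>

text \<open>
  The law of \<open>A\<^sub>t\<close> when the previous state and action are \<open>x\<close> and \<open>a'\<close> and component \<open>m\<close> shows the
  observation \<open>ob\<close>: the other components are averaged out.
\<close>

definition rest_action :: "nat \<Rightarrow> nat \<Rightarrow> (nat \<Rightarrow> 's) \<Rightarrow> 'a \<Rightarrow> 'o \<Rightarrow> 'a pmf" where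
  "rest_action t m x a' ob =
     bind_pmf (Pi_pmf ({1..n_comp P} - {m}) undefined (\<lambda>k. transition P k (x k) a')) (\<lambda>y.
     bind_pmf (Pi_pmf ({1..n_comp P} - {m}) undefined (\<lambda>k. emission P k (y k))) (\<lambda>ob'.
     action_law P \<delta> t (ob'(m := ob))))"

text \<open>
  Sampling component \<open>m\<close> separately from the others is possible because transitions and emissions
  are product measures. The emissions of the others ignore the state of component \<open>m\<close>, so their
  sampling commutes with the emission of \<open>m\<close>, and the action is drawn last from a law that depends
  on component \<open>m\<close> through its observation alone.
\<close>

lemma split_component:
  assumes m: "m \<in> {1..n_comp P}"
  shows "bind_pmf (joint_transition P x a') (\<lambda>y.
      map_pmf (\<lambda>(ob, a). ((y m, ob m), a)) (observe_act P \<delta> t y)) =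
    bind_pmf (bind_pmf (transition P m (x m) a') (\<lambda>s. map_pmf (Pair s) (emission P m s)))
      (\<lambda>z. map_pmf (Pair z) (rest_action t m x a' (snd z)))"
proof -
  let ?I = "{1..n_comp P} - {m}"
  have I: "{1..n_comp P} = insert m ?I" using m by auto
  have Pi: "Pi_pmf {1..n_comp P} undefined p =
      bind_pmf (p m) (\<lambda>v. map_pmf (\<lambda>f. f(m := v)) (Pi_pmf ?I undefined p))" for p :: "nat \<Rightarrow> 'b pmf"
    by (subst I, subst Pi_pmf_insert)
      (auto simp: pair_pmf_def map_bind_pmf map_pmf_def bind_assoc_pmf bind_return_pmf)
  have cong: "Pi_pmf ?I undefined (\<lambda>k. emission P k ((f(m := v)) k)) =
      Pi_pmf ?I undefined (\<lambda>k. emission P k (f k))" for f v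
    by (intro Pi_pmf_cong) auto
  have "bind_pmf (joint_transition P x a') (\<lambda>y.
      map_pmf (\<lambda>(ob, a). ((y m, ob m), a)) (observe_act P \<delta> t y)) =
    bind_pmf (transition P m (x m) a') (\<lambda>s.
    bind_pmf (Pi_pmf ?I undefined (\<lambda>k. transition P k (x k) a')) (\<lambda>y.
    bind_pmf (emission P m s) (\<lambda>ob.
    bind_pmf (Pi_pmf ?I undefined (\<lambda>k. emission P k (y k))) (\<lambda>ob'.
    map_pmf (Pair (s, ob)) (action_law P \<delta> t (ob'(m := ob)))))))"
    unfolding joint_transition_def observe_act_def joint_emission_def Pi
    by (simp only: bind_assoc_pmf bind_map_pmf map_bind_pmf map_pmf_comp cong fun_upd_same prod.case)
  also have "\<dots> = bind_pmf (transition P m (x m) a') (\<lambda>s.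
    bind_pmf (emission P m s) (\<lambda>ob.
    bind_pmf (Pi_pmf ?I undefined (\<lambda>k. transition P k (x k) a')) (\<lambda>y.
    bind_pmf (Pi_pmf ?I undefined (\<lambda>k. emission P k (y k))) (\<lambda>ob'.
    map_pmf (Pair (s, ob)) (action_law P \<delta> t (ob'(m := ob)))))))"
    by (intro bind_pmf_cong refl bind_commute_pmf)
  also have "\<dots> = bind_pmf (bind_pmf (transition P m (x m) a') (\<lambda>s. map_pmf (Pair s) (emission P m s)))
      (\<lambda>z. map_pmf (Pair z) (rest_action t m x a' (snd z)))"
    by (simp add: bind_assoc_pmf bind_map_pmf map_bind_pmf rest_action_def)
  finally show ?thesis .
qed

text \<open>
  Given the previous joint state and action, \<open>split_component\<close> is already such a factorisation. The
  factor \<open>w\<close> integrates the remaining probability of \<open>a\<close> over the event that the previous state has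
  component \<open>s'\<close> and the previous action is \<open>a'\<close>. Integrating over this event, without conditioning
  on it, covers the case in which it has probability zero.
\<close>

lemma policy_ext_factors:
  assumes m: "m \<in> {1..n_comp P}"
  obtains w where "\<And>s. policy_ext t m s' a' s ob a =
    pmf (emission P m s) ob * pmf (transition P m s' a') s * w"
proof
  fix s
  let ?R = "\<lambda>x a'. bind_pmf (joint_transition P x a') (\<lambda>y.
      map_pmf (\<lambda>(ob, a). ((y m, ob m), a)) (observe_act P \<delta> t y))"
  let ?w = "measure_pmf.expectation (decision_law P \<delta> (t - 1))
    (\<lambda>(x, _, b). if x m = s' \<and> b = a' then pmf (rest_action t m x a' ob) a else 0)"
  have R: "pmf (?R x b) ((s, ob), a) =
    pmf (emission P m s) ob * pmf (transition P m (x m) b) s * pmf (rest_action t m x b ob) a" for x b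
    unfolding split_component[OF m] by (simp add: pmf_bind_tagged)
  have tag: "pmf (map_pmf (\<lambda>((s, ob), a). (x m, b, s, ob, a)) (?R x b)) (s', a', s, ob, a) =
    pmf (emission P m s) ob * pmf (transition P m s' a') s *
      (if x m = s' \<and> b = a' then pmf (rest_action t m x a' ob) a else 0)" for x b
  proof (cases "x m = s' \<and> b = a'")
    case True
    have "inj (\<lambda>((s, ob), a). (x m, b, s, ob, a))" by (auto simp: inj_on_def)
    from pmf_map_inj'[OF this, of "?R x b" "((s, ob), a)"] True show ?thesis
      by (simp add: R)
  next
    case False
    then have "(s', a', s, ob, a) \<notin> set_pmf (map_pmf (\<lambda>((s, ob), a). (x m, b, s, ob, a)) (?R x b))"
      by auto
    then show ?thesis using False by (auto simp: pmf_eq_0_set_pmf)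
  qed
  have "window_law P \<delta> t m = bind_pmf (decision_law P \<delta> (t - 1)) (\<lambda>(x, _, b).
      map_pmf (\<lambda>((s, ob), a). (x m, b, s, ob, a)) (?R x b))"
    by (simp add: window_law_def map_bind_pmf map_pmf_comp case_prod_unfold)
  then have "policy_ext t m s' a' s ob a = measure_pmf.expectation (decision_law P \<delta> (t - 1))
    (\<lambda>(x, _, b). pmf (emission P m s) ob * pmf (transition P m s' a') s *
      (if x m = s' \<and> b = a' then pmf (rest_action t m x a' ob) a else 0))"
    unfolding policy_ext_def by (simp only: pmf_bind case_prod_unfold tag[unfolded case_prod_unfold])
  then show "policy_ext t m s' a' s ob a =
      pmf (emission P m s) ob * pmf (transition P m s' a') s * ?w"
    by (simp add: case_prod_unfold)
qed

lemma policy_vars_extra_equalities: "extra_equalities P c policy_vars policy_ext"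
  unfolding extra_equalities_def
proof (intro ballI conjI)
  fix m t s ob a assume m: "m \<in> {1..n_comp P}" and t: "t \<in> {2..horizon P}"
    and s: "s \<in> states P m" and ob: "ob \<in> observations P m" and a: "a \<in> actions P"
  have t': "t - 1 \<in> {1..horizon P}" and Suc: "t = Suc (t - 1)" using t by auto
  let ?Q = "window_law P \<delta> t m"
  let ?h = "\<lambda>(s', a'). (s', a', s, ob, a)"
  have "(\<Sum>s'\<in>states P m. \<Sum>a'\<in>actions P. policy_ext t m s' a' s ob a) =
    (\<Sum>z\<in>states P m \<times> actions P. pmf ?Q (?h z))"
    by (simp add: sum.cartesian_product policy_ext_def case_prod_unfold)
  also have "\<dots> = pmf (map_pmf (\<lambda>(s', a', s, ob, a). (s, ob, a)) ?Q) (s, ob, a)"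
    using finite_states[OF m] finite_actions set_window_law[OF m t]
    by (intro sum_pmf_eq_pmf_map) (fastforce simp: inj_on_def)+
  also have "map_pmf (\<lambda>(s', a', s, ob, a). (s, ob, a)) ?Q =
      map_pmf (\<lambda>(x, ob, a). (x m, ob m, a)) (decision_law P \<delta> t)"
  proof -
    have "state_law P \<delta> t = bind_pmf (decision_law P \<delta> (t - 1)) (\<lambda>(x, _, a). joint_transition P x a)"
      using t' state_law_Suc[of "t - 1" P \<delta>] Suc by simp
    then show ?thesis
      by (simp add: window_law_def decision_law_def[of P \<delta> t] map_bind_pmf bind_assoc_pmf
          map_pmf_comp case_prod_unfold)
  qed
  finally show "(\<Sum>s'\<in>states P m. \<Sum>a'\<in>actions P. policy_ext t m s' a' s ob a) =
      tau_soa policy_vars t m s ob a"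
    by (simp add: policy_vars_def)
next
  fix m t s s' ob a' assume m: "m \<in> {1..n_comp P}" and t: "t \<in> {2..horizon P}"
    and s: "s \<in> states P m" and s': "s' \<in> states P m" and ob: "ob \<in> observations P m"
    and a': "a' \<in> actions P"
  let ?Q = "window_law P \<delta> t m"
  let ?B = "bind_pmf (decision_law P \<delta> (t - 1)) (\<lambda>(x, _, a).
      map_pmf (\<lambda>y. ((x m, a), y m)) (joint_transition P x a))"
  have "(\<Sum>a\<in>actions P. policy_ext t m s' a' s ob a) =
     pmf (map_pmf (\<lambda>(s', a', s, ob, a). (((s', a'), s), ob)) ?Q) (((s', a'), s), ob)"
    unfolding policy_ext_def
    using finite_actions set_window_law[OF m t]
    by (intro sum_pmf_eq_pmf_map) (fastforce simp: inj_on_def)+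
  also have "map_pmf (\<lambda>(s', a', s, ob, a). (((s', a'), s), ob)) ?Q =
    bind_pmf (decision_law P \<delta> (t - 1)) (\<lambda>(x, _, a'). bind_pmf (joint_transition P x a') (\<lambda>y.
      map_pmf (\<lambda>ob. (((x m, a'), y m), ob m)) (joint_emission P y)))"
    by (simp add: window_law_def observe_act_def map_bind_pmf map_pmf_comp case_prod_unfold
        map_pmf_const) (simp add: map_pmf_def)
  also have "\<dots> = bind_pmf ?B (\<lambda>z. map_pmf (Pair z) (emission P m (snd z)))"
    by (simp add: bind_map_pmf map_joint_emission[OF m, symmetric] map_pmf_comp bind_assoc_pmf
        case_prod_unfold)
  finally show "(\<Sum>a\<in>actions P. policy_ext t m s' a' s ob a) =
      pmf (emission P m s) ob * pmf (transition P m s' a') s * tau_sa policy_vars (t - 1) m s' a'"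
    by (simp add: pmf_bind_tagged tau_sa_transition[OF m])
next
  fix m t s s' ob a a' assume m: "m \<in> {1..n_comp P}" and s: "s \<in> states P m"
  obtain w where w: "\<And>s. policy_ext t m s' a' s ob a =
      pmf (emission P m s) ob * pmf (transition P m s' a') s * w"
    using policy_ext_factors[OF m] by blast
  let ?d = "\<Sum>sb\<in>states P m. pmf (emission P m sb) ob * pmf (transition P m s' a') sb"
  have sum: "(\<Sum>sb\<in>states P m. policy_ext t m s' a' sb ob a) = ?d * w"
    by (simp add: w sum_distrib_right)
  show "policy_ext t m s' a' s ob a =
      posterior P c m s s' a' ob * (\<Sum>sb\<in>states P m. policy_ext t m s' a' sb ob a)"
  proof (cases "?d = 0")
    case True
    \<comment> \<open>Here the posterior is arbitrary, but it multiplies \<open>0\<close>, and the left side is a multiple of a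
      term of the vanishing sum.\<close>
    then have "pmf (emission P m s) ob * pmf (transition P m s' a') s = 0"
      using s finite_states[OF m] by (subst (asm) sum_nonneg_eq_0_iff) auto
    then have "policy_ext t m s' a' s ob a = 0" by (simp only: w mult_zero_left)
    then show ?thesis unfolding sum True by simp
  next
    case False
    then show ?thesis unfolding sum unfolding w posterior_def Let_def by simp
  qed
qed

lemma policy_vars_augmented_feasible: "(policy_vars, policy_ext) \<in> augmented_feasible P c"
  by (simp add: augmented_feasible_def policy_vars_lp_feasible policy_vars_extra_equalities)

end

section \<open>A feasible point that uses hidden information\<close>

text \<open>
  All components are alike, so that one candidate solution serves every number of components.
\<close>

definition coin_pomdp :: "nat \<Rightarrow> nat \<Rightarrow> (nat, nat, nat) dpomdp" where
  "coin_pomdp M T =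
    \<lparr> n_comp = M, horizon = T, states = \<lambda>_. {0, 1}, observations = \<lambda>_. {0}, actions = {0, 1},
      init = \<lambda>_. pmf_of_set {0, 1}, emission = \<lambda>_ _. return_pmf 0,
      transition = \<lambda>_ _ _. pmf_of_set {0, 1}, reward = \<lambda>_ _ _ _. 0 \<rparr>"

text \<open>
  Every component claims that the action equals its own state. Components need not agree on more than
  the law of the action, which is uniform in each of them, so the linear program accepts the claims.
\<close>

definition clairvoyant_vars :: "(nat, nat, nat) lp_vars" where
  "clairvoyant_vars =
    \<lparr> tau_s = \<lambda>_ _ _. 1 / 2, tau_sa = \<lambda>_ _ s a. if a = s then 1 / 2 else 0,
      tau_soa = \<lambda>_ _ s _ a. if a = s then 1 / 2 else 0, tau_a = \<lambda>_ _. 1 / 2 \<rparr>"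

lemma decomposable_coin_pomdp: "M \<ge> 1 \<Longrightarrow> T \<ge> 1 \<Longrightarrow> decomposable_pomdp (coin_pomdp M T)"
  by (simp add: decomposable_pomdp_def coin_pomdp_def)

lemma clairvoyant_vars_lp_feasible: "lp_feasible (coin_pomdp M T) clairvoyant_vars"
  by (auto simp: lp_feasible_def lp_nonneg_def coin_pomdp_def clairvoyant_vars_def)

text \<open>
  The observation is constant and the transition uniform, so the posterior is \<open>1/2\<close> for both states
  and the third family of equalities makes \<open>\<sigma>\<close> equal on them. Summing over the previous state and action gives
  equal values of \<open>\<tau>\<^sub>s\<^sub>o\<^sub>a\<close>, while the action \<open>0\<close> has value \<open>1/2\<close> in state \<open>0\<close> and \<open>0\<close> in state \<open>1\<close>.
\<close>

lemma clairvoyant_vars_not_extra_equalities: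
  assumes "M \<ge> 1" and "T \<ge> 2"
  shows "\<not> extra_equalities (coin_pomdp M T) c clairvoyant_vars \<sigma>"
proof
  assume eq: "extra_equalities (coin_pomdp M T) c clairvoyant_vars \<sigma>"
  have carriers: "states (coin_pomdp M T) 1 = {0, 1}" "observations (coin_pomdp M T) 1 = {0}"
    "actions (coin_pomdp M T) = {0, 1}"
    by (simp_all add: coin_pomdp_def)
  have "1 \<in> {1..n_comp (coin_pomdp M T)}" "2 \<in> {2..horizon (coin_pomdp M T)}"
    using assms by (simp_all add: coin_pomdp_def)
  note eqs = bspec[OF bspec[OF eq[unfolded extra_equalities_def] this(1)] this(2), unfolded carriers]
  have marginal: "(\<Sum>s'\<in>{0, 1}. \<Sum>a'\<in>{0, 1}. \<sigma> 2 1 s' a' s 0 0) =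
      tau_soa clairvoyant_vars 2 1 s 0 0" if "s \<in> {0, 1}" for s
    using eqs[THEN conjunct1] that by blast
  have bayes: "\<sigma> 2 1 s' a' s 0 0 = posterior (coin_pomdp M T) c 1 s s' a' 0 *
      (\<Sum>sb\<in>{0, 1}. \<sigma> 2 1 s' a' sb 0 0)"
    if "s \<in> {0, 1}" "s' \<in> {0, 1}" "a' \<in> {0, 1}" for s s' a'
    using eqs[THEN conjunct2, THEN conjunct2] that by blast
  have "posterior (coin_pomdp M T) c 1 s s' a' 0 = 1 / 2" if "s \<in> {0, 1}" for s s' a'
    using that by (auto simp: posterior_def coin_pomdp_def)
  with bayes have "\<sigma> 2 1 s' a' 0 0 0 = \<sigma> 2 1 s' a' 1 0 0"
    if "s' \<in> {0, 1}" "a' \<in> {0, 1}" for s' a'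
    using that by (metis insertI1 insertI2)
  then have "(\<Sum>s'\<in>{0, 1}. \<Sum>a'\<in>{0, 1}. \<sigma> 2 1 s' a' 0 0 0) =
      (\<Sum>s'\<in>{0, 1}. \<Sum>a'\<in>{0, 1}. \<sigma> 2 1 s' a' 1 0 0)"
    by (intro sum.cong) auto
  then show False
    unfolding marginal[OF insertI1] marginal[OF insertI2[OF singletonI]]
    by (simp add: clairvoyant_vars_def)
qed

theorem proposition2:
  fixes M T :: nat
  assumes "M \<ge> 1" and "T \<ge> 2"
  shows
    "(\<forall>(P :: ('s, 'o, 'a) dpomdp) c.
        decomposable_pomdp P \<and> n_comp P = M \<and> horizon P = T \<longrightarrow>
          (\<forall>\<delta>\<in>policies P. \<exists>(\<tau>, \<sigma>)\<in>augmented_feasible P c.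
             lp_objective P \<tau> \<ge> expected_reward P \<delta>) \<and>
          memoryless_value P \<le> augmented_value P c) \<and>
     (\<exists>(P :: (nat, nat, nat) dpomdp) \<tau>.
        decomposable_pomdp P \<and> n_comp P = M \<and> horizon P = T \<and>
        lp_feasible P \<tau> \<and>
        (\<forall>c. \<not> (\<exists>\<sigma>. extra_equalities P c \<tau> \<sigma>)))"
proof (intro conjI allI impI)
  fix P :: "('s, 'o, 'a) dpomdp" and c
  assume P: "decomposable_pomdp P \<and> n_comp P = M \<and> horizon P = T"
  show relaxation: "\<forall>\<delta>\<in>policies P. \<exists>(\<tau>, \<sigma>)\<in>augmented_feasible P c.
      lp_objective P \<tau> \<ge> expected_reward P \<delta>"
  proof
    fix \<delta> assume "\<delta> \<in> policies P"
    with P interpret controlled_pomdp P \<delta> by unfold_locales auto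
    show "\<exists>(\<tau>, \<sigma>)\<in>augmented_feasible P c. lp_objective P \<tau> \<ge> expected_reward P \<delta>"
      using policy_vars_augmented_feasible lp_objective_policy_vars by force
  qed
  show "memoryless_value P \<le> augmented_value P c"
    unfolding memoryless_value_def augmented_value_def
    using relaxation by (intro SUP_mono) force
next
  show "\<exists>(P :: (nat, nat, nat) dpomdp) \<tau>.
      decomposable_pomdp P \<and> n_comp P = M \<and> horizon P = T \<and> lp_feasible P \<tau> \<and>
      (\<forall>c. \<not> (\<exists>\<sigma>. extra_equalities P c \<tau> \<sigma>))"
    using assms decomposable_coin_pomdp clairvoyant_vars_lp_feasible
      clairvoyant_vars_not_extra_equalities
    by (intro exI[of _ "coin_pomdp M T"] exI[of _ clairvoyant_vars]) (auto simp: coin_pomdp_def)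
qed

end
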